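(* Let $c>1$ satisfy $\zeta(c)=\sum_{i\ge1}i^{-c}>2$. Then $b(n)=\Omega(n^c)$; that is, there exists a constant $a>0$ such that $b(n)\ge a\,n^c$ for all positive integers $n$. Here $b(n)$ denotes the minimum number of leaves of a rooted tree that contains, as a topological minor, every binary rooted tree with $n$ leaves and no degree-1 nodes.
   Context: Trees are rooted and unordered, with edges directed from parent to child. The degree of a node is its number of children; a degree-1 node has exactly one child. A tree is binary if every node has at most two children. $T'$ is a topological minor of $T$ if there is an injective map $f$ from the nodes of $T'$ to the nodes of $T$ with $f(\mathsf{NCA}(u,v))=\mathsf{NCA}(f(u),f(v))$ for all $u,v$. Equivalently, $T$ contains a subdivision of $T'$ as a subgraph. $\mathsf{NCA}$ denotes the nearest common ancestor. *)

theory Defs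
  imports Complex_Main "HOL-Library.Sublist"
begin

text \<open>Rooted trees; children are listed, but all notions below are invariant
under reordering children, so this models unordered rooted trees.
Nodes of a tree are identified with their positions (paths from the root).\<close>

datatype tree = Node "tree list"

inductive is_pos :: "tree \<Rightarrow> nat list \<Rightarrow> bool" where
  root: "is_pos t []"
| child: "i < length ts \<Longrightarrow> is_pos (ts ! i) p \<Longrightarrow> is_pos (Node ts) (i # p)"

definition nodes :: "tree \<Rightarrow> nat list set" where
  "nodes t = {p. is_pos t p}"

definition degree :: "tree \<Rightarrow> nat list \<Rightarrow> nat" where
  "degree t p = card {i. is_pos t (p @ [i])}"

definition leaves :: "tree \<Rightarrow> nat list set" where
  "leaves t = {p \<in> nodes t. degree t p = 0}"

definition num_leaves :: "tree \<Rightarrow> nat" where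
  "num_leaves t = card (leaves t)"

definition full_binary :: "tree \<Rightarrow> bool" where
  "full_binary t \<longleftrightarrow> (\<forall>p \<in> nodes t. degree t p = 0 \<or> degree t p = 2)"

definition NCA :: "nat list \<Rightarrow> nat list \<Rightarrow> nat list" where
  "NCA u v = longest_common_prefix u v"

definition top_minor :: "tree \<Rightarrow> tree \<Rightarrow> bool" where
  "top_minor T' T \<longleftrightarrow> (\<exists>f. inj_on f (nodes T') \<and> f ` nodes T' \<subseteq> nodes T \<and>
     (\<forall>u \<in> nodes T'. \<forall>v \<in> nodes T'. f (NCA u v) = NCA (f u) (f v)))"

definition universal :: "nat \<Rightarrow> tree \<Rightarrow> bool" where
  "universal n T \<longleftrightarrow> (\<forall>T'. full_binary T' \<and> num_leaves T' = n \<longrightarrow> top_minor T' T)"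

definition b :: "nat \<Rightarrow> nat" where
  "b n = (LEAST k. \<exists>T. universal n T \<and> num_leaves T = k)"

end

theory Submission
  imports Defs
begin

text \<open>
Close the one-node tree under the operations \<open>A \<mapsto> A\<^sup>i\<close> (\<open>i \<ge> 2\<close>), where \<open>A\<^sup>i\<close> is a caterpillar carrying
\<open>i\<close> copies of \<open>A\<close>. The resulting trees correspond to ordered factorizations of their
numbers of leaves. A tree \<open>T\<close> contains at most as many of them as it has leaves, by induction on \<open>T\<close>:
if the root of \<open>T\<close> is the image of the root of \<open>A\<^sup>i\<close>, then \<open>A\<close> occurs in two different children, and
only one exponent \<open>i\<close> can be new for this \<open>A\<close>; so the new trees are paid for by those counted twice
among the children. Hence \<open>b n\<close> is at least the number \<open>G n\<close> of ordered
factorizations of the numbers up to \<open>n\<close>. Splitting off one factor yields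
\<open>G x \<ge> (\<Sum>i=2..K. G (x / i))\<close> for real \<open>x\<close>, and \<open>(\<Sum>i=2..K. 1 / i powr c) \<ge> 1\<close> for some \<open>K\<close> because
\<open>\<zeta>(c) > 2\<close>; so \<open>G\<close> grows at least like \<open>n powr c\<close>.
\<close>

section \<open>Positions, leaves and embeddings\<close>

lemma is_pos_Nil [simp]: "is_pos t []"
  by (rule is_pos.root)

lemma is_pos_Node_Cons [simp]: "is_pos (Node ts) (i # p) \<longleftrightarrow> i < length ts \<and> is_pos (ts ! i) p"
  by (auto intro: is_pos.child elim: is_pos.cases)

lemma Nil_in_nodes [simp]: "[] \<in> nodes t"
  by (simp add: nodes_def)

lemma Cons_in_nodes [simp]: "i # p \<in> nodes (Node ts) \<longleftrightarrow> i < length ts \<and> p \<in> nodes (ts ! i)"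
  by (simp add: nodes_def)

lemma NCA_simps [simp]:
  "NCA [] v = []" "NCA u [] = []"
  "NCA (i # u) (j # v) = (if i = j then i # NCA u v else [])"
  by (simp_all add: NCA_def)

lemma nodes_Node: "nodes (Node ts) = insert [] (\<Union>j<length ts. (#) j ` nodes (ts ! j))"
proof (rule set_eqI)
  fix p show "p \<in> nodes (Node ts) \<longleftrightarrow> p \<in> insert [] (\<Union>j<length ts. (#) j ` nodes (ts ! j))"
    by (cases p) auto
qed

lemma finite_nodes [simp]: "finite (nodes t)"
proof (induction t)
  case (Node ts)
  then show ?case by (simp add: nodes_Node)
qed

lemma degree_Nil [simp]: "degree (Node ts) [] = length ts"
  by (simp add: degree_def)

lemma degree_Cons [simp]: "i < length ts \<Longrightarrow> degree (Node ts) (i # p) = degree (ts ! i) p"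
  by (simp add: degree_def)

lemma leaves_Node:
  assumes "ts \<noteq> []"
  shows "leaves (Node ts) = (\<Union>j<length ts. (#) j ` leaves (ts ! j))"
proof (rule set_eqI)
  fix p show "p \<in> leaves (Node ts) \<longleftrightarrow> p \<in> (\<Union>j<length ts. (#) j ` leaves (ts ! j))"
    using assms by (cases p) (fastforce simp: leaves_def)+
qed

lemma finite_leaves [simp]: "finite (leaves t)"
  by (simp add: leaves_def)

lemma num_leaves_leaf [simp]: "num_leaves (Node []) = 1"
proof -
  have "leaves (Node []) = {[]}"
    by (auto simp: leaves_def nodes_Node)
  then show ?thesis by (simp add: num_leaves_def)
qed

lemma num_leaves_Node:
  assumes "ts \<noteq> []"
  shows "num_leaves (Node ts) = (\<Sum>j<length ts. num_leaves (ts ! j))"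
proof -
  have "card (\<Union>j<length ts. (#) j ` leaves (ts ! j)) = (\<Sum>j<length ts. card ((#) j ` leaves (ts ! j)))"
    by (rule card_UN_disjoint) auto
  also have "\<dots> = (\<Sum>j<length ts. num_leaves (ts ! j))"
    by (simp add: card_image num_leaves_def)
  finally show ?thesis
    using assms by (simp add: num_leaves_def leaves_Node)
qed

lemma num_leaves_binary [simp]: "num_leaves (Node [l, r]) = num_leaves l + num_leaves r"
  by (simp add: num_leaves_Node lessThan_Suc)

lemma num_leaves_pos: "num_leaves t > 0"
proof (induction t)
  case (Node ts)
  show ?case
  proof (cases "ts = []")
    case False
    then have "num_leaves (ts ! 0) > 0"
      using Node by simp
    then show ?thesis
      using False by (auto simp: num_leaves_Node intro!: sum_pos2[of _ 0])
  qed simp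
qed

lemma full_binary_Node:
  "full_binary (Node ts) \<longleftrightarrow> (length ts = 0 \<or> length ts = 2) \<and> (\<forall>t\<in>set ts. full_binary t)"
  by (auto simp: full_binary_def nodes_Node all_set_conv_all_nth)

definition embedding :: "(nat list \<Rightarrow> nat list) \<Rightarrow> tree \<Rightarrow> tree \<Rightarrow> bool" where
  "embedding f S T \<longleftrightarrow> inj_on f (nodes S) \<and> f ` nodes S \<subseteq> nodes T \<and>
     (\<forall>u \<in> nodes S. \<forall>v \<in> nodes S. f (NCA u v) = NCA (f u) (f v))"

lemma top_minor_iff_embedding: "top_minor S T \<longleftrightarrow> (\<exists>f. embedding f S T)"
  by (simp add: top_minor_def embedding_def)

lemma embedding_child:
  assumes "embedding f (Node ss) T" "i < length ss"
  shows "embedding (\<lambda>p. f (i # p)) (ss ! i) T"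
  unfolding embedding_def
proof (intro conjI ballI)
  show "inj_on (\<lambda>p. f (i # p)) (nodes (ss ! i))"
    using assms unfolding embedding_def inj_on_def by (metis Cons_in_nodes list.inject)
  show "(\<lambda>p. f (i # p)) ` nodes (ss ! i) \<subseteq> nodes T"
    using assms by (auto simp: embedding_def image_subset_iff)
  fix u v assume "u \<in> nodes (ss ! i)" "v \<in> nodes (ss ! i)"
  then have "f (NCA (i # u) (i # v)) = NCA (f (i # u)) (f (i # v))"
    using assms unfolding embedding_def by (metis Cons_in_nodes)
  then show "f (i # NCA u v) = NCA (f (i # u)) (f (i # v))" by simp
qed

text \<open>Since \<open>f [] = NCA (f []) (f u)\<close>, the image of the root is a prefix of every
  \<open>f u\<close>. So the whole image lies in child \<open>a\<close>, and \<open>tl\<close>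
  strips the common first letter.\<close>

lemma embedding_into_child:
  assumes f: "embedding f S (Node ts)" and root: "f [] = a # p"
  shows "a < length ts \<and> top_minor S (ts ! a)"
proof -
  have pre: "f u = a # tl (f u)" if "u \<in> nodes S" for u
  proof -
    have "f (NCA [] u) = NCA (f []) (f u)"
      using f that Nil_in_nodes unfolding embedding_def by blast
    then show ?thesis
      by (cases "f u") (auto simp: root split: if_splits)
  qed
  have sub: "a # tl (f u) \<in> nodes (Node ts)" if "u \<in> nodes S" for u
    using f that pre[OF that] by (auto simp: embedding_def)
  have "embedding (tl \<circ> f) S (ts ! a)"
    unfolding embedding_def
  proof (intro conjI ballI)
    show "inj_on (tl \<circ> f) (nodes S)"
    proof (rule inj_onI)
      fix u v assume "u \<in> nodes S" "v \<in> nodes S" "(tl \<circ> f) u = (tl \<circ> f) v"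
      moreover from this have "f u = f v"
        using pre by (metis comp_apply)
      ultimately show "u = v"
        using f by (auto simp: embedding_def inj_on_def)
    qed
    show "(tl \<circ> f) ` nodes S \<subseteq> nodes (ts ! a)"
      using sub by auto
    fix u v assume uv: "u \<in> nodes S" "v \<in> nodes S"
    have "f (NCA u v) = NCA (f u) (f v)"
      using f uv by (simp add: embedding_def)
    also have "\<dots> = a # NCA (tl (f u)) (tl (f v))"
      using pre[OF uv(1)] pre[OF uv(2)] NCA_simps(3) by metis
    finally show "(tl \<circ> f) (NCA u v) = NCA ((tl \<circ> f) u) ((tl \<circ> f) v)"
      by simp
  qed
  then show ?thesis
    using sub[of "[]"] by (auto simp: top_minor_iff_embedding)
qed

lemma top_minor_child:
  assumes "top_minor (Node ss) T" "i < length ss"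
  shows "top_minor (ss ! i) T"
  using assms embedding_child unfolding top_minor_iff_embedding by blast

lemma top_minor_right: "top_minor (Node [A, B]) T \<Longrightarrow> top_minor B T"
  using top_minor_child[of "[A, B]" T 1] by simp

text \<open>Either the root is mapped strictly below the root, or \<open>f [] = []\<close>. In the
  latter case \<open>f [0]\<close> and \<open>f [1]\<close> are nonempty by injectivity and their
  \<open>NCA\<close> is \<open>[]\<close>, so they lie in different children.\<close>

lemma top_minor_Node_cases:
  assumes "top_minor (Node [A, B]) (Node ts)"
  obtains (child) j where "j < length ts" "top_minor (Node [A, B]) (ts ! j)"
  | (root) j k where "j < length ts" "k < length ts" "j \<noteq> k" "top_minor A (ts ! j)" "top_minor B (ts ! k)"
proof -
  obtain f where f: "embedding f (Node [A, B]) (Node ts)"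
    using assms by (auto simp: top_minor_iff_embedding)
  show thesis
  proof (cases "f []")
    case (Cons j q)
    then show thesis
      using embedding_into_child[OF f] child by blast
  next
    case Nil
    have nodes: "[] \<in> nodes (Node [A, B])" "[0] \<in> nodes (Node [A, B])" "[1] \<in> nodes (Node [A, B])"
      by auto
    have inj: "f u = f v \<Longrightarrow> u = v" if "u \<in> nodes (Node [A, B])" "v \<in> nodes (Node [A, B])" for u v
      using f that by (auto simp: embedding_def inj_on_def)
    have "f [0] \<noteq> []" "f [1] \<noteq> []"
      using inj[OF nodes(2,1)] inj[OF nodes(3,1)] Nil by auto
    then obtain j p k q where jk: "f [0] = j # p" "f [1] = k # q"
      by (meson neq_Nil_conv)
    have "f (NCA [0] [1]) = NCA (f [0]) (f [1])"
      using f nodes unfolding embedding_def by blast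
    then have "j \<noteq> k"
      using Nil jk by auto
    moreover have "j < length ts \<and> top_minor A (ts ! j)"
      using embedding_into_child[OF embedding_child[OF f, of 0]] jk by auto
    moreover have "k < length ts \<and> top_minor B (ts ! k)"
      using embedding_into_child[OF embedding_child[OF f, of 1]] jk by auto
    ultimately show thesis
      using root by blast
  qed
qed

lemma top_minor_leaf: "top_minor (Node []) T"
  unfolding top_minor_def by (rule exI[of _ id]) (auto simp: nodes_Node)

text \<open>\<open>NCA\<close> depends only on the two positions and not on the tree, so the
  identity is an embedding.\<close>

lemma top_minor_if_nodes_subset:
  assumes "nodes S \<subseteq> nodes T"
  shows "top_minor S T"
  unfolding top_minor_def using assms by (intro exI[of _ id]) auto

section \<open>Iterated caterpillars\<close>

text \<open>\<open>caterpillar k A\<close> carries \<open>k + 1\<close> copies of \<open>A\<close>.\<close>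

primrec caterpillar :: "nat \<Rightarrow> tree \<Rightarrow> tree" where
  "caterpillar 0 A = A"
| "caterpillar (Suc k) A = Node [A, caterpillar k A]"

text \<open>A word \<open>[k\<^sub>1, \<dots>, k\<^sub>d]\<close> encodes the ordered factorization with factors
  \<open>k\<^sub>1 + 2, \<dots>, k\<^sub>d + 2\<close>, all at least 2, of the number of leaves.\<close>

primrec word_tree :: "nat list \<Rightarrow> tree" where
  "word_tree [] = Node []"
| "word_tree (k # w) = caterpillar (Suc k) (word_tree w)"

primrec weight :: "nat list \<Rightarrow> nat" where
  "weight [] = 1"
| "weight (k # w) = (k + 2) * weight w"

lemma full_binary_caterpillar: "full_binary A \<Longrightarrow> full_binary (caterpillar k A)"
  by (induction k) (auto simp: full_binary_Node)

lemma full_binary_word_tree: "full_binary (word_tree w)"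
proof (induction w)
  case Nil
  show ?case by (simp add: full_binary_Node)
next
  case (Cons k w)
  then show ?case
    unfolding word_tree.simps by (rule full_binary_caterpillar)
qed

lemma num_leaves_caterpillar: "num_leaves (caterpillar k A) = (k + 1) * num_leaves A"
  by (induction k) auto

lemma num_leaves_word_tree: "num_leaves (word_tree w) = weight w"
  by (induction w) (auto simp: num_leaves_caterpillar)

lemma top_minor_caterpillar_mono:
  assumes "top_minor (caterpillar k A) T" "j \<le> k"
  shows "top_minor (caterpillar j A) T"
  using assms(2,1)
proof (induction k rule: dec_induct)
  case (step k)
  then show ?case by (auto dest: top_minor_right)
qed

text \<open>\<open>universal n\<close> speaks only of trees with exactly \<open>n\<close> leaves.
  Putting new roots with one extra leaf each above \<open>S\<close> reaches \<open>n\<close> and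
  keeps \<open>S\<close> as a subtree.\<close>

lemma universal_top_minor_le:
  assumes "universal n T" "full_binary S" "num_leaves S \<le> n"
  shows "top_minor S T"
proof -
  define pad where "pad k = ((\<lambda>t. Node [Node [], t]) ^^ k) S" for k
  have pad: "full_binary (pad k) \<and> num_leaves (pad k) = k + num_leaves S" for k
    using assms(2) by (induction k) (auto simp: pad_def full_binary_Node)
  have minor: "top_minor (pad k) T \<Longrightarrow> top_minor S T" for k
    by (induction k) (auto simp: pad_def dest: top_minor_right)
  have "top_minor (pad (n - num_leaves S)) T"
    using assms pad by (simp add: universal_def)
  then show ?thesis by (rule minor)
qed

section \<open>Counting words contained in a tree\<close>

definition words :: "tree \<Rightarrow> nat list set" where
  "words T = {w. top_minor (word_tree w) T}"

lemma words_leaf: "words (Node []) = {[]}"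
proof -
  have "w = []" if "top_minor (word_tree w) (Node [])" for w
    using that by (cases w) (auto elim: top_minor_Node_cases)
  then show ?thesis
    by (auto simp: words_def top_minor_leaf)
qed

text \<open>A word that first appears at the root of \<open>T\<close> is \<open>k # w\<close> with \<open>w\<close> contained in two different
  children and \<open>k\<close> the least value for which no child contains \<open>k # w\<close>; so it is determined
  by \<open>w\<close>.\<close>

lemma new_words_Node:
  assumes v: "v \<in> words (Node ts)" "v \<notin> (\<Union>j<length ts. words (ts ! j))" and ts: "ts \<noteq> []"
  obtains k w i j where "v = k # w" "i < length ts" "j < length ts" "i \<noteq> j"
    "w \<in> words (ts ! i)" "w \<in> words (ts ! j)"
    "\<And>l. l < k \<Longrightarrow> l # w \<in> (\<Union>j<length ts. words (ts ! j))"
proof (cases v)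
  case Nil
  then have "v \<in> words (ts ! 0)"
    by (simp add: words_def top_minor_leaf)
  then show ?thesis
    using v(2) ts by auto
next
  case (Cons k w)
  have "top_minor (Node [word_tree w, caterpillar k (word_tree w)]) (Node ts)"
    using v(1) Cons by (simp add: words_def)
  then show ?thesis
  proof (cases rule: top_minor_Node_cases)
    case (child j)
    then show ?thesis
      using v(2) Cons by (auto simp: words_def)
  next
    case (root i j)
    have j: "w \<in> words (ts ! j)"
      using top_minor_caterpillar_mono[OF root(5), of 0] by (simp add: words_def)
    \<comment> \<open>\<open>word_tree (l # w)\<close> is
      \<open>caterpillar (Suc l) (word_tree w)\<close>, and the second subtree in \<open>v\<close>
      is \<open>caterpillar k (word_tree w)\<close>; hence exactly the letters \<open>l < k\<close>
      are reached.\<close>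
    have "l # w \<in> words (ts ! j)" if "l < k" for l
      using top_minor_caterpillar_mono[OF root(5), of "Suc l"] that by (simp add: words_def)
    then show ?thesis
      using that[OF Cons root(1,2,3) _ j] root by (auto simp: words_def)
  qed
qed

text \<open>Double counting: the right-hand side counts each element of the union at least once, and
  each element of the overlap at least twice.\<close>

lemma card_Union_plus_card_overlap_le:
  assumes "finite I" "\<And>i. i \<in> I \<Longrightarrow> finite (A i)"
  shows "card (\<Union>i\<in>I. A i) + card {x. \<exists>i\<in>I. \<exists>j\<in>I. i \<noteq> j \<and> x \<in> A i \<and> x \<in> A j}
    \<le> (\<Sum>i\<in>I. card (A i))"
proof -
  define U where "U = (\<Union>i\<in>I. A i)"
  define D where "D = {x. \<exists>i\<in>I. \<exists>j\<in>I. i \<noteq> j \<and> x \<in> A i \<and> x \<in> A j}"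
  have fin: "finite U" and sub: "D \<subseteq> U"
    using assms by (auto simp: U_def D_def)
  have count: "1 + of_bool (x \<in> D) \<le> card {i \<in> I. x \<in> A i}" if "x \<in> U" for x
  proof (cases "x \<in> D")
    case True
    then obtain i j where "i \<in> I" "j \<in> I" "i \<noteq> j" "x \<in> A i" "x \<in> A j"
      by (auto simp: D_def)
    then have "card {i, j} \<le> card {i \<in> I. x \<in> A i}"
      using assms(1) by (intro card_mono) auto
    then show ?thesis
      using \<open>i \<noteq> j\<close> True by simp
  next
    case False
    then show ?thesis
      using that assms(1) by (auto simp: U_def Suc_le_eq card_gt_0_iff)
  qed
  have "card U + card D = (\<Sum>x\<in>U. 1 + of_bool (x \<in> D))"
    unfolding sum.distrib using fin sub by (simp add: sum_of_bool_eq Int_absorb1)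
  also have "\<dots> \<le> (\<Sum>x\<in>U. card {i \<in> I. x \<in> A i})"
    using count by (rule sum_mono)
  also have "\<dots> = (\<Sum>i\<in>I. card {x \<in> U. x \<in> A i})"
    using fin assms(1) by (intro sum_multicount_gen[symmetric]) auto
  also have "\<dots> = (\<Sum>i\<in>I. card (A i))"
    by (intro sum.cong arg_cong[of _ _ card]) (auto simp: U_def)
  finally show ?thesis
    by (simp add: U_def D_def)
qed

text \<open>Finiteness is carried through the induction because \<open>card\<close> is 0 on infinite
  sets and the double count needs finite sets.\<close>

lemma card_words_le_num_leaves: "finite (words T) \<and> card (words T) \<le> num_leaves T"
proof (induction T)
  case (Node ts)
  show ?case
  proof (cases "ts = []")
    case True
    then show ?thesis by (simp add: words_leaf)
  next
    case False
    define I where "I = {..<length ts}"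
    define U where "U = (\<Union>j\<in>I. words (ts ! j))"
    define D where "D = {w. \<exists>i\<in>I. \<exists>j\<in>I. i \<noteq> j \<and> w \<in> words (ts ! i) \<and> w \<in> words (ts ! j)}"
    define N where "N = words (Node ts) - U"
    have IH: "finite (words (ts ! j))" "card (words (ts ! j)) \<le> num_leaves (ts ! j)" if "j \<in> I" for j
      using Node that by (auto simp: I_def)
    have fin: "finite I" "finite U" "finite D"
      using IH(1) by (auto simp: I_def U_def D_def intro: rev_finite_subset)
    have new: "\<exists>k w. v = k # w \<and> w \<in> D \<and> (\<forall>l<k. l # w \<in> U)" if "v \<in> N" for v
      using that False unfolding N_def U_def D_def I_def
      by (elim DiffE, elim new_words_Node) blast+
    have inj: "inj_on tl N"
    proof (rule inj_onI)
      fix u v assume uv: "u \<in> N" "v \<in> N" "tl u = tl v"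
      obtain k w where u: "u = k # w" "\<forall>l<k. l # w \<in> U"
        using new[OF uv(1)] by blast
      obtain k' w' where v: "v = k' # w'" "\<forall>l<k'. l # w' \<in> U"
        using new[OF uv(2)] by blast
      \<comment> \<open>Here \<open>w = w'\<close>. If \<open>k < k'\<close>, then
        \<open>u = k # w'\<close> would lie in \<open>U\<close>, which \<open>N\<close> excludes;
        the other case is symmetric.\<close>
      have "\<not> k < k'" "\<not> k' < k"
        using u v uv by (auto simp: N_def)
      then show "u = v"
        using u v uv by simp
    qed
    have img: "tl ` N \<subseteq> D"
      using new by fastforce
    have finN: "finite N"
      using inj img fin(3) by (meson finite_imageD finite_subset)
    have "card N \<le> card D"
      using inj img fin(3) by (rule card_inj_on_le)
    have sub: "words (Node ts) \<subseteq> U \<union> N"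
      by (auto simp: N_def)
    have "card (words (Node ts)) \<le> card (U \<union> N)"
      using sub fin finN by (intro card_mono) auto
    also have "\<dots> \<le> card U + card N"
      by (rule card_Un_le)
    also have "\<dots> \<le> card U + card D"
      using \<open>card N \<le> card D\<close> by simp
    also have "\<dots> \<le> (\<Sum>j\<in>I. card (words (ts ! j)))"
      unfolding U_def D_def using fin(1) IH(1) by (rule card_Union_plus_card_overlap_le)
    also have "\<dots> \<le> (\<Sum>j\<in>I. num_leaves (ts ! j))"
      using IH(2) by (rule sum_mono)
    also have "\<dots> = num_leaves (Node ts)"
      using False by (simp add: num_leaves_Node I_def)
    finally show ?thesis
      using finite_subset[OF sub] fin finN by simp
  qed
qed

section \<open>Existence of universal trees\<close>

primrec complete :: "nat \<Rightarrow> tree" where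
  "complete 0 = Node []"
| "complete (Suc d) = Node [complete d, complete d]"

text \<open>Each child leaves at least one leaf to its sibling, so the bound on leaves drops by one
  per level and the depth is at most \<open>d\<close>.\<close>

lemma nodes_full_binary_subset_complete:
  "full_binary t \<Longrightarrow> num_leaves t \<le> Suc d \<Longrightarrow> nodes t \<subseteq> nodes (complete d)"
proof (induction t arbitrary: d)
  case (Node ts)
  show ?case
  proof (cases "ts = []")
    case True
    then show ?thesis by (auto simp: nodes_Node)
  next
    case False
    then obtain l r where ts: "ts = [l, r]"
      using Node.prems(1) by (auto simp: full_binary_Node length_Suc_conv numeral_2_eq_2)
    have "num_leaves l > 0" "num_leaves r > 0"
      by (rule num_leaves_pos)+
    then obtain e where e: "d = Suc e" "num_leaves l \<le> Suc e" "num_leaves r \<le> Suc e"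
      using Node.prems(2) ts by (cases d) auto
    have "nodes l \<subseteq> nodes (complete e)" "nodes r \<subseteq> nodes (complete e)"
      using Node e by (auto simp: ts full_binary_Node)
    then show ?thesis
      by (auto simp: ts e(1) nodes_Node lessThan_Suc)
  qed
qed

text \<open>Without a universal tree, \<open>LEAST\<close> in the definition of \<open>b\<close> would be unspecified.\<close>

lemma universal_complete: "universal n (complete n)"
  unfolding universal_def
  by (intro allI impI top_minor_if_nodes_subset nodes_full_binary_subset_complete) auto

section \<open>Counting ordered factorizations\<close>

text \<open>The bound is real so that dividing it by a factor involves no rounding.\<close>

definition bounded_words :: "real \<Rightarrow> nat list set" where
  "bounded_words x = {w. real (weight w) \<le> x}"

lemma weight_pos: "weight w > 0"
  by (induction w) auto

lemma length_le_weight: "length w \<le> weight w"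
proof (induction w)
  case (Cons k w)
  then show ?case using weight_pos[of w] by simp
qed simp

lemma letter_le_weight: "k \<in> set w \<Longrightarrow> k \<le> weight w"
proof (induction w)
  case (Cons j w)
  have "j * 1 \<le> (j + 2) * weight w" "1 * weight w \<le> (j + 2) * weight w"
    using weight_pos[of w] by (intro mult_le_mono; simp)+
  with Cons show ?case by fastforce
qed simp

lemma finite_bounded_words: "finite (bounded_words x)"
proof (rule finite_subset)
  show "bounded_words x \<subseteq> {w. set w \<subseteq> {..nat \<lfloor>x\<rfloor>} \<and> length w \<le> nat \<lfloor>x\<rfloor>}"
    using length_le_weight letter_le_weight
    by (fastforce simp: bounded_words_def le_nat_floor intro: le_trans)
qed (simp add: finite_lists_length_le)

lemma card_bounded_words_ge_sum:
  "(\<Sum>k<K. card (bounded_words (x / real (k + 2)))) \<le> card (bounded_words x)"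
proof -
  have "(\<Sum>k<K. card (bounded_words (x / real (k + 2)))) = (\<Sum>k<K. card ((#) k ` bounded_words (x / real (k + 2))))"
    by (simp add: card_image)
  also have "\<dots> = card (\<Union>k<K. (#) k ` bounded_words (x / real (k + 2)))"
    by (rule card_UN_disjoint[symmetric]) (auto simp: finite_bounded_words)
  also have "\<dots> \<le> card (bounded_words x)"
    by (intro card_mono finite_bounded_words) (auto simp: bounded_words_def field_simps)
  finally show ?thesis .
qed

text \<open>The constant makes the claimed bound at most 1 for \<open>x \<le> K + 2\<close>, where
  the empty word suffices. For larger \<open>x\<close> every quotient \<open>x / (k + 2)\<close>
  with \<open>k < K\<close> is at least 1, and its floor is smaller because
  \<open>x / 2 \<le> x - 1\<close>.\<close>

lemma card_bounded_words_ge_powr: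
  fixes c x :: real
  assumes K: "(\<Sum>k<K. 1 / real (k + 2) powr c) \<ge> 1" and "c > 0" "x \<ge> 1"
  shows "real (card (bounded_words x)) \<ge> (1 / real (K + 2) powr c) * x powr c"
  using \<open>x \<ge> 1\<close>
proof (induction "nat \<lfloor>x\<rfloor>" arbitrary: x rule: less_induct)
  case less
  define a where "a = 1 / real (K + 2) powr c"
  have "a \<ge> 0" by (simp add: a_def)
  show ?case
  proof (cases "x \<le> real (K + 2)")
    case True
    have "[] \<in> bounded_words x"
      using less.prems by (simp add: bounded_words_def)
    then have "real (card (bounded_words x)) \<ge> 1"
      using finite_bounded_words by (metis One_nat_def Suc_leI card_gt_0_iff empty_iff of_nat_1 of_nat_le_iff)
    moreover have "x powr c \<le> real (K + 2) powr c"
      using True less.prems \<open>c > 0\<close> by (intro powr_mono2) auto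
    ultimately have "x powr c \<le> real (card (bounded_words x)) * real (K + 2) powr c"
      by (metis mult_mono mult_1 of_nat_0_le_iff powr_ge_zero order_trans)
    then show ?thesis
      by (simp add: field_simps)
  next
    case False
    have IH: "a * (x / real (k + 2)) powr c \<le> real (card (bounded_words (x / real (k + 2))))" if "k < K" for k
      unfolding a_def
    proof (rule less.hyps)
      show "1 \<le> x / real (k + 2)"
        using False that by (simp add: field_simps)
      have "x / real (k + 2) \<le> x / 2"
        using less.prems by (intro divide_left_mono) auto
      moreover have "x / 2 \<le> x - 1"
        using False by simp
      ultimately have "x / real (k + 2) \<le> x - 1"
        by linarith
      then have "\<lfloor>x / real (k + 2)\<rfloor> \<le> \<lfloor>x\<rfloor> - 1"
        using floor_mono by fastforce
      then show "nat \<lfloor>x / real (k + 2)\<rfloor> < nat \<lfloor>x\<rfloor>"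
        using less.prems by linarith
    qed
    have "a * x powr c \<le> a * x powr c * (\<Sum>k<K. 1 / real (k + 2) powr c)"
      using K mult_left_mono[OF K, of "a * x powr c"] \<open>a \<ge> 0\<close> by simp
    also have "\<dots> = (\<Sum>k<K. a * (x / real (k + 2)) powr c)"
      using less.prems by (simp add: sum_distrib_left powr_divide)
    also have "\<dots> \<le> (\<Sum>k<K. real (card (bounded_words (x / real (k + 2)))))"
      using IH by (intro sum_mono) simp
    also have "\<dots> \<le> real (card (bounded_words x))"
      using card_bounded_words_ge_sum[where K = K and x = x] by (simp flip: of_nat_sum)
    finally show ?thesis
      by (simp add: a_def)
  qed
qed

section \<open>The lower bound for \<open>b\<close>\<close>

lemma b_ge_card_bounded_words: "b n \<ge> card (bounded_words (real n))"
proof -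
  have "\<exists>T. universal n T \<and> num_leaves T = b n"
    unfolding b_def by (rule LeastI_ex) (use universal_complete in blast)
  then obtain T where T: "universal n T" "num_leaves T = b n"
    by blast
  have "bounded_words (real n) \<subseteq> words T"
    using universal_top_minor_le[OF T(1)]
    by (auto simp: bounded_words_def words_def full_binary_word_tree num_leaves_word_tree)
  then show ?thesis
    using card_words_le_num_leaves[of T] T(2) by (metis card_mono le_trans)
qed

text \<open>Partial sums bounded by \<open>L\<close> would force summability, by nonnegativity, and
  then a limit of at most \<open>L\<close>. Thus the unspecified value of \<open>suminf\<close> on a
  divergent series does no harm.\<close>

lemma partial_sum_gt_if_suminf_gt:
  fixes f :: "nat \<Rightarrow> real"
  assumes "\<And>i. f i \<ge> 0" "suminf f > L"
  obtains n where "sum f {..<n} > L"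
proof (rule ccontr)
  assume "\<not> thesis"
  then have le: "sum f {..<n} \<le> L" for n
    using that not_le by blast
  then have "summable f"
    using assms(1) by (intro summableI_nonneg_bounded)
  then have "suminf f \<le> L"
    using le by (rule suminf_le_const)
  with assms(2) show False by simp
qed

theorem theorem5:
  fixes c :: real
  assumes "c > 1"
    and "(\<Sum>i. 1 / real (Suc i) powr c) > 2"
  shows "\<exists>a > 0. \<forall>n :: nat. n \<ge> 1 \<longrightarrow> real (b n) \<ge> a * real n powr c"
proof -
  obtain N where N: "(\<Sum>i<N. 1 / real (Suc i) powr c) > 2"
    using partial_sum_gt_if_suminf_gt[OF _ assms(2)] by auto
  then obtain K where "N = Suc K"
    by (cases N) auto
  \<comment> \<open>Removing the term 1 at \<open>i = 0\<close> turns the bound 2 into 1 and shifts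
    the bases to \<open>k + 2\<close>, the factors encoded by letters.\<close>
  with N have K: "(\<Sum>k<K. 1 / real (k + 2) powr c) \<ge> 1"
    unfolding \<open>N = Suc K\<close> sum.lessThan_Suc_shift by (simp add: add.commute)
  have "real (b n) \<ge> (1 / real (K + 2) powr c) * real n powr c" if "n \<ge> 1" for n
  proof -
    have "(1 / real (K + 2) powr c) * real n powr c \<le> real (card (bounded_words (real n)))"
      using card_bounded_words_ge_powr[OF K, of "real n"] assms(1) that by simp
    also have "\<dots> \<le> real (b n)"
      using b_ge_card_bounded_words by simp
    finally show ?thesis .
  qed
  then show ?thesis
    by (intro exI[of _ "1 / real (K + 2) powr c"]) auto
qed

end
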